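(* Let $\mathcal{H}$ be a complex separable Hilbert space, let $A$ be a bounded and injective operator on $\mathcal{H}$, let $g\in\operatorname{ran}A$, and let $f\in\mathcal{H}$ be the solution to $Af=g$. Then the following hold. (i) If $f\in\overline{\mathcal{K}(A,g)}$, then $A\,\overline{\mathcal{K}(A,g)}$ is dense in $\overline{\mathcal{K}(A,g)}$. (ii) Assume further that $A$ is invertible with everywhere defined, bounded inverse on $\mathcal{H}$. Then $f\in\overline{\mathcal{K}(A,g)}$ if and only if $A\,\overline{\mathcal{K}(A,g)}$ is dense in $\overline{\mathcal{K}(A,g)}$.
   Context: Bounded operators on $\mathcal{H}$ are linear and everywhere defined. For a bounded operator $A$ on $\mathcal{H}$ and $g\in\mathcal{H}$, the Krylov subspace is $\mathcal{K}(A,g):=\operatorname{span}\{A^kg\mid k\in\mathbb{N}_0\}$ (finite linear combinations, $\mathbb{N}_0=\{0,1,2,\dots\}$), and $\overline{\mathcal{K}(A,g)}$ is its closure in the norm of $\mathcal{H}$. One always has $A\,\overline{\mathcal{K}(A,g)}\subset\overline{\mathcal{K}(A,g)}$. *)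

theory Defs
  imports "HOL-Analysis.Analysis"
begin

text \<open>
  Complex inner product spaces as a type class. The real normed structure is inherited from
  \<^class>\<open>real_normed_vector\<close>, so that the topological library applies; \<open>scaleR_scaleC\<close> and
  \<open>norm_eq_sqrt_cinner\<close> tie it to the complex structure. The norm axioms inherited in this way
  are consequences of the remaining ones. The inner product is linear in its second argument.
\<close>

class complex_inner = real_normed_vector +
  fixes scaleC :: "complex \<Rightarrow> 'a \<Rightarrow> 'a"  (infixr \<open>*\<^sub>C\<close> 75)
    and cinner :: "'a \<Rightarrow> 'a \<Rightarrow> complex"
  assumes scaleC_add_right: "a *\<^sub>C (x + y) = a *\<^sub>C x + a *\<^sub>C y"
    and scaleC_add_left: "(a + b) *\<^sub>C x = a *\<^sub>C x + b *\<^sub>C x"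
    and scaleC_scaleC: "a *\<^sub>C b *\<^sub>C x = (a * b) *\<^sub>C x"
    and scaleC_one: "1 *\<^sub>C x = x"
    and scaleR_scaleC: "scaleR r x = complex_of_real r *\<^sub>C x"
    and cinner_commute: "cinner x y = cnj (cinner y x)"
    and cinner_add_right: "cinner x (y + z) = cinner x y + cinner x z"
    and cinner_scaleC_right: "cinner x (a *\<^sub>C y) = a * cinner x y"
    and norm_eq_sqrt_cinner: "norm x = sqrt (Re (cinner x x))"

class complex_hilbert_space = complex_inner + complete_space

instantiation complex :: complex_hilbert_space
begin

definition scaleC_complex_def: "scaleC (a :: complex) (x :: complex) = a * x"

definition cinner_complex_def: "cinner (x :: complex) (y :: complex) = cnj x * y"

instance
  by standard
    (auto simp: scaleC_complex_def cinner_complex_def scaleR_conv_of_real algebra_simps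
      cmod_def power2_eq_square)

end

global_interpretation complex_vector: vector_space "scaleC :: complex \<Rightarrow> 'a \<Rightarrow> 'a :: complex_inner"
  defines cspan = complex_vector.span
  by unfold_locales (simp_all add: scaleC_add_right scaleC_add_left scaleC_scaleC scaleC_one)

definition bounded_clinear :: "('a::complex_inner \<Rightarrow> 'b::complex_inner) \<Rightarrow> bool" where
  "bounded_clinear A \<longleftrightarrow>
     Vector_Spaces.linear scaleC scaleC A \<and> (\<exists>K. \<forall>x. norm (A x) \<le> K * norm x)"

definition boundedly_invertible :: "('a::complex_inner \<Rightarrow> 'a) \<Rightarrow> bool" where
  "boundedly_invertible A \<longleftrightarrow> (\<exists>B. bounded_clinear B \<and> B \<circ> A = id \<and> A \<circ> B = id)"

definition krylov :: "('a::complex_inner \<Rightarrow> 'a) \<Rightarrow> 'a \<Rightarrow> 'a set" where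
  "krylov A g = cspan {(A ^^ k) g | k :: nat. True}"

definition dense_in :: "'a::topological_space set \<Rightarrow> 'a set \<Rightarrow> bool" where
  "dense_in S T \<longleftrightarrow> S \<subseteq> T \<and> T \<subseteq> closure S"

end

theory Submission
  imports Defs
begin

text \<open>
  Write \<open>K\<close> for the Krylov subspace. Since \<open>A\<close> is linear, maps the generators \<open>A\<^sup>k g\<close> of \<open>K\<close> to
  generators, and is continuous, it maps \<open>closure K\<close> into itself; so density only concerns the
  inclusion of \<open>closure K\<close> in \<open>closure (A ` closure K)\<close>.

  The generators \<open>A\<^sup>k g\<close> with \<open>k > 0\<close> always lie in the linear space \<open>A ` closure K\<close>, and the
  remaining one, \<open>g = A f\<close>, lies there as soon as \<open>f \<in> closure K\<close>. In that case all of \<open>K\<close> is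
  contained in \<open>A ` closure K\<close>, not merely in its closure, which is the density in (i).

  Conversely, if \<open>A\<close> has a bounded inverse \<open>B\<close>, density places \<open>g\<close> in the closure of
  \<open>A ` closure K\<close>, and the continuous map \<open>B\<close> carries this closure into \<open>closure K\<close>. As
  \<open>f = B g\<close>, it follows that \<open>f \<in> closure K\<close>.
\<close>

lemma norm_scaleC: "norm (a *\<^sub>C x) = cmod a * norm (x :: 'a :: complex_inner)"
proof -
  have "cinner (a *\<^sub>C x) (a *\<^sub>C x) = a * cnj (cinner x (a *\<^sub>C x))"
    by (metis cinner_commute cinner_scaleC_right)
  also have "\<dots> = (a * cnj a) * cinner x x"
    by (metis cinner_commute cinner_scaleC_right complex_cnj_mult mult.assoc)
  also have "\<dots> = complex_of_real ((cmod a)\<^sup>2) * cinner x x"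
    by (simp only: complex_norm_square)
  finally show ?thesis
    by (simp add: norm_eq_sqrt_cinner[where 'a = 'a] real_sqrt_mult
        flip: of_real_power)
qed

lemma bounded_clinear_imp_bounded_linear:
  fixes A :: "'a::complex_inner \<Rightarrow> 'b::complex_inner"
  assumes "bounded_clinear A"
  shows "bounded_linear A"
proof -
  from assms obtain K where lin: "Vector_Spaces.linear scaleC scaleC A"
    and K: "\<And>x. norm (A x) \<le> K * norm x"
    by (auto simp: bounded_clinear_def)
  interpret Vector_Spaces.linear scaleC scaleC A by (fact lin)
  show ?thesis
    using K by (intro bounded_linear_intro[of A K])
      (simp_all add: add scale scaleR_scaleC mult.commute)
qed

lemma bounded_linear_image_closure_subset:
  assumes "bounded_linear A"
  shows "A ` closure S \<subseteq> closure (A ` S)"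
  using closure_subset[of "A ` S"]
  by (intro image_closure_subset linear_continuous_on[OF assms]) auto

lemma bounded_linear_scaleC: "bounded_linear (\<lambda>x :: 'a :: complex_inner. a *\<^sub>C x)"
  by (rule bounded_linear_intro[of _ "cmod a"])
    (simp_all add: scaleC_add_right scaleR_scaleC scaleC_scaleC norm_scaleC mult.commute)

lemma csubspace_closure:
  fixes S :: "'a::complex_inner set"
  assumes "complex_vector.subspace S"
  shows "complex_vector.subspace (closure S)"
proof (rule complex_vector.subspaceI)
  show "0 \<in> closure S"
    using complex_vector.subspace_0[OF assms] closure_subset by blast
next
  fix x y assume "x \<in> closure S" "y \<in> closure S"
  then obtain u v where "\<And>n. u n \<in> S" "u \<longlonglongrightarrow> x" "\<And>n. v n \<in> S" "v \<longlonglongrightarrow> y"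
    by (auto simp: closure_sequential)
  then have "(\<lambda>n. u n + v n) \<longlonglongrightarrow> x + y" "\<And>n. u n + v n \<in> S"
    by (auto intro: tendsto_add complex_vector.subspace_add[OF assms])
  then show "x + y \<in> closure S"
    unfolding closure_sequential by (intro exI[of _ "\<lambda>n. u n + v n"]) simp
next
  fix c x assume "x \<in> closure S"
  then have "c *\<^sub>C x \<in> closure ((\<lambda>x. c *\<^sub>C x) ` S)"
    using bounded_linear_image_closure_subset[OF bounded_linear_scaleC] by blast
  moreover have "(\<lambda>x. c *\<^sub>C x) ` S \<subseteq> S"
    using complex_vector.subspace_scale[OF assms] by blast
  ultimately show "c *\<^sub>C x \<in> closure S"
    using closure_mono by blast
qed

lemma csubspace_image:
  assumes "Vector_Spaces.linear scaleC scaleC A" and "complex_vector.subspace S"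
  shows "complex_vector.subspace (A ` S)"
proof -
  interpret Vector_Spaces.linear scaleC scaleC A by (fact assms(1))
  show ?thesis
    using assms(2) by (rule subspace_image)
qed

lemma csubspace_krylov: "complex_vector.subspace (krylov A g)"
  by (simp add: krylov_def)

lemma funpow_in_krylov: "(A ^^ k) g \<in> krylov A g"
  unfolding krylov_def by (rule complex_vector.span_base) blast

lemma krylov_minimal:
  assumes "complex_vector.subspace S" and "\<And>k. (A ^^ k) g \<in> S"
  shows "krylov A g \<subseteq> S"
  unfolding krylov_def using assms by (intro complex_vector.span_minimal) auto

lemma image_krylov_subset:
  assumes "Vector_Spaces.linear scaleC scaleC A"
  shows "A ` krylov A g \<subseteq> krylov A g"
proof -
  interpret Vector_Spaces.linear scaleC scaleC A by (fact assms)
  have "krylov A g \<subseteq> A -` krylov A g"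
  proof (rule krylov_minimal)
    show "complex_vector.subspace (A -` krylov A g)"
      using csubspace_krylov by (rule subspace_vimage)
    show "(A ^^ k) g \<in> A -` krylov A g" for k
      using funpow_in_krylov[of "Suc k" A g] by simp
  qed
  then show ?thesis by blast
qed

lemma image_closure_krylov_subset:
  assumes "bounded_clinear A"
  shows "A ` closure (krylov A g) \<subseteq> closure (krylov A g)"
proof -
  have "A ` closure (krylov A g) \<subseteq> closure (A ` krylov A g)"
    by (intro bounded_linear_image_closure_subset bounded_clinear_imp_bounded_linear assms)
  also have "\<dots> \<subseteq> closure (krylov A g)"
    using assms by (intro closure_mono image_krylov_subset) (simp add: bounded_clinear_def)
  finally show ?thesis .
qed

text \<open>
  Every generator is an image: \<open>g = A f\<close> by assumption on \<open>f\<close>, the others by shifting the exponent.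
\<close>

lemma krylov_subset_image_closure:
  assumes "Vector_Spaces.linear scaleC scaleC A" and "f \<in> closure (krylov A (A f))"
  shows "krylov A (A f) \<subseteq> A ` closure (krylov A (A f))"
proof (rule krylov_minimal)
  show "complex_vector.subspace (A ` closure (krylov A (A f)))"
    by (intro csubspace_image csubspace_closure csubspace_krylov assms)
  show "(A ^^ k) (A f) \<in> A ` closure (krylov A (A f))" for k
  proof (cases k)
    case 0
    then show ?thesis using assms(2) by simp
  next
    case (Suc j)
    then show ?thesis
      using funpow_in_krylov[of j A "A f"] closure_subset by auto
  qed
qed

lemma dense_in_image_closure_krylov:
  assumes "bounded_clinear A" and "f \<in> closure (krylov A (A f))"
  shows "dense_in (A ` closure (krylov A (A f))) (closure (krylov A (A f)))"
  using assms image_closure_krylov_subset[OF assms(1)]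
    closure_mono[OF krylov_subset_image_closure[of A f]]
  by (simp add: dense_in_def bounded_clinear_def)

text \<open>
  A bounded left inverse of \<open>A\<close> pulls limits of points \<open>A x\<close> with \<open>x\<close> in a closed set back to limits
  of the points \<open>x\<close> themselves; applied to the limit \<open>A f\<close>, this recovers \<open>f\<close>.
\<close>

lemma solution_in_closure_krylov:
  assumes "bounded_clinear B" and "B \<circ> A = id"
    and "dense_in (A ` closure (krylov A (A f))) (closure (krylov A (A f)))"
  shows "f \<in> closure (krylov A (A f))"
proof -
  have BA: "B (A x) = x" for x
    using assms(2) by (metis comp_apply id_apply)
  have "A f \<in> closure (krylov A (A f))"
    using funpow_in_krylov[of 0 A "A f"] closure_subset by auto
  then have "A f \<in> closure (A ` closure (krylov A (A f)))"
    using assms(3) by (auto simp: dense_in_def)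
  then have "B (A f) \<in> closure (B ` A ` closure (krylov A (A f)))"
    using bounded_linear_image_closure_subset[OF bounded_clinear_imp_bounded_linear[OF assms(1)]]
    by blast
  then show ?thesis
    by (simp add: BA image_image)
qed

theorem proposition3p2:
  fixes A :: "'h::complex_hilbert_space \<Rightarrow> 'h" and f g :: 'h
  assumes "separable_space (euclidean :: 'h topology)"
    and "bounded_clinear A" and "inj A"
    and "g \<in> range A" and "A f = g"
  shows "(f \<in> closure (krylov A g) \<longrightarrow>
            dense_in (A ` closure (krylov A g)) (closure (krylov A g)))
       \<and> (boundedly_invertible A \<longrightarrow>
            (f \<in> closure (krylov A g) \<longleftrightarrow>
             dense_in (A ` closure (krylov A g)) (closure (krylov A g))))"
  using dense_in_image_closure_krylov[OF assms(2), of f] solution_in_closure_krylov[of _ A f]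
  unfolding boundedly_invertible_def assms(5) by blast

end
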